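(* Let $n\ge1$ be an integer, let $f\in\mathcal{A}_n$, $0\leq\alpha<1$ and $\lambda>0$. Suppose that $$|zf''(z)-\alpha(f'(z)-1)|<\frac{\delta(n+1)(n-\alpha)}{\alpha+(n+1)(n-\alpha)}\qquad(z\in\mathbb{D}),$$ where $\delta$ is the smallest positive root of $$\phi(r):=(1+n)\bigl(2\alpha n-\lambda(n+1)-n\bigr)r^2+n(1-\alpha+n)\bigl(2\lambda(n+1)+n+\alpha n^2\bigr)r-\lambda n^2(n+1-\alpha)^2.$$ Then $f\in G_{\lambda,\alpha}$.
   Context: $\mathbb{D}=\{z\in\mathbb{C}:|z|<1\}$. For an integer $n\ge1$, $\mathcal{A}_n$ is the class of analytic functions on $\mathbb{D}$ of the form $f(z)=z+a_{n+1}z^{n+1}+a_{n+2}z^{n+2}+\cdots$, and $\mathcal{A}=\mathcal{A}_1$. For $0\le\alpha\le1$ and $\lambda>0$, $$G_{\lambda,\alpha}=\left\{f\in\mathcal{A}:\left|\frac{1-\alpha+\alpha zf''(z)/f'(z)}{zf'(z)/f(z)}-(1-\alpha)\right|<\lambda,\ z\in\mathbb{D}\right\},$$ where expressions such as $zf'(z)/f(z)$ are given their limiting values at $z=0$. *)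

theory Defs
  imports "HOL-Complex_Analysis.Complex_Analysis"
begin

definition class_A :: "nat \<Rightarrow> (complex \<Rightarrow> complex) set" where
  "class_A n = {f. f analytic_on ball 0 1 \<and>
     (\<exists>a :: nat \<Rightarrow> complex. \<forall>z\<in>ball 0 1. (\<lambda>k. a (n + 1 + k) * z ^ (n + 1 + k)) sums (f z - z))}"

definition at0_limit :: "(complex \<Rightarrow> complex) \<Rightarrow> complex \<Rightarrow> complex" where
  "at0_limit h z = (if z = 0 then Lim (at 0) h else h z)"

text \<open>
  The two non-vanishing conditions say that the quotients zf''/f' and zf'/f make sense in the
  disc (the latter by its limit at 0). They must be explicit because HOL evaluates x / 0 to 0,
  so that, e.g., the inequality alone could hold at a zero of f'.
\<close>
definition class_G :: "real \<Rightarrow> real \<Rightarrow> (complex \<Rightarrow> complex) set" where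
  "class_G lam \<alpha> = {f \<in> class_A 1.
     (\<forall>z\<in>ball 0 1. deriv f z \<noteq> 0) \<and> (\<forall>z\<in>ball 0 1 - {0}. f z \<noteq> 0) \<and>
     (\<forall>z\<in>ball 0 1.
        cmod ((1 - of_real \<alpha> + of_real \<alpha> * at0_limit (\<lambda>w. w * deriv (deriv f) w / deriv f w) z)
                / at0_limit (\<lambda>w. w * deriv f w / f w) z
              - (1 - of_real \<alpha>)) < lam)}"

definition phi :: "nat \<Rightarrow> real \<Rightarrow> real \<Rightarrow> real \<Rightarrow> real" where
  "phi n \<alpha> lam r =
     (1 + real n) * (2 * \<alpha> * real n - lam * (real n + 1) - real n) * r\<^sup>2
     + real n * (1 - \<alpha> + real n) * (2 * lam * (real n + 1) + real n + \<alpha> * (real n)\<^sup>2) * r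
     - lam * (real n)\<^sup>2 * (real n + 1 - \<alpha>)\<^sup>2"

text \<open>Unspecified if there is no least positive root.\<close>
definition smallest_positive_root :: "(real \<Rightarrow> real) \<Rightarrow> real" where
  "smallest_positive_root p = (LEAST r. 0 < r \<and> p r = 0)"

end

theory Submission
  imports Defs
begin

text \<open>
  Write \<open>f z = z + z ^ (n + 1) * h z\<close> and \<open>D c h z = c * h z + z * h' z\<close>. Then \<open>f' = 1 + z ^ n * q\<close> with
  \<open>q = D (n + 1) h\<close>, and the function bounded by hypothesis is \<open>z ^ n * D (n - \<alpha>) q\<close>, so the maximum
  principle bounds \<open>D (n - \<alpha>) q\<close>. A bound \<open>B\<close> on \<open>D c h\<close> gives the bound \<open>B / c\<close> on \<open>h\<close>, because
  \<open>t powr c * h (t * z)\<close> has derivative \<open>t powr (c - 1) * D c h (t * z)\<close>. Iterating this bounds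
  \<open>f' - 1\<close>, \<open>f / z - 1\<close>, \<open>z * f''\<close> and \<open>f' - f / z\<close>, and the equation \<open>phi n \<alpha> lam \<delta> = 0\<close> says exactly
  that the resulting estimate of the quantity defining \<open>class_G\<close> is \<open>lam * cmod z ^ n\<close>.
\<close>

section \<open>Operators of the form c + z d/dz and the bounds they transfer\<close>

definition euler_op :: "complex \<Rightarrow> (complex \<Rightarrow> complex) \<Rightarrow> complex \<Rightarrow> complex" where
  "euler_op c h z = c * h z + z * deriv h z"

lemma holomorphic_euler_op [holomorphic_intros]:
  "h holomorphic_on A \<Longrightarrow> open A \<Longrightarrow> euler_op c h holomorphic_on A"
  unfolding euler_op_def by (intro holomorphic_intros)

lemma has_field_derivative_euler_op:
  assumes "h holomorphic_on A" "open A" "z \<in> A"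
  shows "(euler_op c h has_field_derivative (c + 1) * deriv h z + z * deriv (deriv h) z) (at z)"
proof -
  have "(h has_field_derivative deriv h z) (at z)"
    "(deriv h has_field_derivative deriv (deriv h) z) (at z)"
    using assms by (auto intro!: holomorphic_derivI holomorphic_deriv)
  then have "((\<lambda>z. c * h z + z * deriv h z) has_field_derivative
      (c + 1) * deriv h z + z * deriv (deriv h) z) (at z)"
    by (auto intro!: derivative_eq_intros simp: algebra_simps)
  then show ?thesis
    by (simp add: euler_op_def[abs_def])
qed

text \<open>Both operators are z d/dz plus a constant. Commuting them lets a bound on
  \<open>euler_op n (euler_op (n + 1) h)\<close> descend to \<open>euler_op n h\<close>.\<close>

lemma euler_op_commute:
  assumes "h holomorphic_on A" "open A" "z \<in> A"
  shows "euler_op c (euler_op d h) z = euler_op d (euler_op c h) z"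
proof -
  have "deriv (euler_op e h) z = (e + 1) * deriv h z + z * deriv (deriv h) z" for e
    using has_field_derivative_euler_op[OF assms] by (rule DERIV_imp_deriv)
  then show ?thesis
    unfolding euler_op_def[of c "euler_op d h"] euler_op_def[of d "euler_op c h"]
    by (simp add: euler_op_def algebra_simps)
qed

lemma has_field_derivative_power_mult:
  assumes "h holomorphic_on A" "open A" "z \<in> A"
  shows "((\<lambda>z. z ^ Suc m * h z) has_field_derivative z ^ m * euler_op (of_nat (Suc m)) h z) (at z)"
proof -
  have "(h has_field_derivative deriv h z) (at z)"
    using assms by (auto intro!: holomorphic_derivI)
  from DERIV_mult[OF DERIV_power_Suc[OF DERIV_ident] this, of m] show ?thesis
    by (simp add: euler_op_def algebra_simps)
qed

lemma norm_le_of_euler_op_bound: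
  assumes holo: "h holomorphic_on ball 0 1" and c: "0 < c"
    and bound: "\<And>z. cmod z < 1 \<Longrightarrow> cmod (euler_op (of_real c) h z) \<le> B"
    and z: "cmod z < 1"
  shows "cmod (h z) \<le> B / c"
proof -
  define F where "F t = (t powr c) *\<^sub>R h (of_real t * z)" for t :: real
  define F' where "F' t = (t powr (c - 1)) *\<^sub>R euler_op (of_real c) h (of_real t * z)" for t :: real
  have inb: "cmod (of_real t * z) < 1" if "0 \<le> t" "t \<le> 1" for t :: real
    using that z mult_left_le_one_le[of "cmod z" t] by (simp add: norm_mult)
  \<comment> \<open>Mean value inequality against \<open>B / c * t powr c\<close>. For
    \<open>c < 1\<close> the factor \<open>t powr (c - 1)\<close> is unbounded near 0, so
    derivatives are taken only inside the interval, with mere continuity at its ends.\<close>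
  have "norm (F 1 - F 0) \<le> B / c * 1 powr c - B / c * 0 powr c"
  proof (rule differentiable_bound_general[where f = F and f' = F'
        and \<phi> = "\<lambda>t. B / c * t powr c" and \<phi>' = "\<lambda>t. B * t powr (c - 1)"])
    have "continuous_on {0..1} (\<lambda>t. h (of_real t * z))"
      by (rule continuous_on_compose2[OF holomorphic_on_imp_continuous_on[OF holo]])
        (auto intro!: continuous_intros simp: inb)
    then show "continuous_on {0..1} F"
      unfolding F_def using c by (intro continuous_intros continuous_on_powr') auto
    show "continuous_on {0..1} (\<lambda>t. B / c * t powr c)"
      using c by (intro continuous_intros continuous_on_powr') auto
    fix t :: real assume t: "0 < t" "t < 1"
    show "((\<lambda>t. B / c * t powr c) has_vector_derivative B * t powr (c - 1)) (at t)"
      using t c unfolding has_real_derivative_iff_has_vector_derivative[symmetric]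
      by (auto intro!: derivative_eq_intros)
    have "(h has_field_derivative deriv h (of_real t * z)) (at (of_real t * z))"
      using holo inb[of t] t by (intro holomorphic_derivI[of h "ball 0 1"]) auto
    moreover have "((\<lambda>t. of_real t * z) has_vector_derivative z) (at t)"
      by (auto intro!: derivative_eq_intros)
    ultimately have "((\<lambda>t. h (of_real t * z)) has_vector_derivative z * deriv h (of_real t * z)) (at t)"
      using field_vector_diff_chain_at[of "\<lambda>t. of_real t * z" z t h] by (simp add: o_def)
    moreover have "((\<lambda>t. t powr c) has_real_derivative c * t powr (c - 1)) (at t)"
      using t by (auto intro!: derivative_eq_intros)
    ultimately have "(F has_vector_derivative
        t powr c *\<^sub>R (z * deriv h (of_real t * z)) + (c * t powr (c - 1)) *\<^sub>R h (of_real t * z)) (at t)"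
      unfolding F_def by (intro has_vector_derivative_scaleR)
    moreover have "t powr c = t * t powr (c - 1)"
      using t by (simp add: powr_diff)
    ultimately show "(F has_vector_derivative F' t) (at t)"
      by (simp add: F'_def euler_op_def scaleR_conv_of_real algebra_simps)
    show "norm (F' t) \<le> B * t powr (c - 1)"
      using bound[OF inb[of t]] t by (simp add: F'_def mult.commute mult_right_mono)
  qed auto
  then show ?thesis
    using c by (simp add: F_def)
qed

text \<open>On the circle of radius \<open>r\<close> the division by \<open>z ^ n\<close> costs a
  factor \<open>1 / r ^ n\<close>. The maximum principle carries that bound inside, and the factor
  tends to 1 as \<open>r\<close> does.\<close>

lemma norm_le_of_power_mult_bound:
  assumes holo: "Q holomorphic_on ball 0 1"
    and bound: "\<And>z. cmod z < 1 \<Longrightarrow> cmod (z ^ n * Q z) \<le> M"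
    and z: "cmod z < 1"
  shows "cmod (Q z) \<le> M"
proof -
  have le: "cmod (Q z) \<le> M / r ^ n" if r: "cmod z < r" "r < 1" for r
  proof (rule maximum_modulus_frontier[of Q "cball 0 r"])
    have r0: "0 < r"
      using r norm_ge_zero[of z] by linarith
    have sub: "cball 0 r \<subseteq> ball (0::complex) 1"
      using r by auto
    show "Q holomorphic_on interior (cball 0 r)" "continuous_on (closure (cball 0 r)) Q"
      using holomorphic_on_subset[OF holo sub] holomorphic_on_subset[OF holo, of "ball 0 r"] r
      by (auto intro: holomorphic_on_imp_continuous_on)
    show "cmod (Q w) \<le> M / r ^ n" if "w \<in> frontier (cball 0 r)" for w
      using that r r0 bound[of w] by (simp add: norm_mult norm_power field_simps)
  qed (use r in auto)
  have "((\<lambda>r. M / r ^ n) \<longlongrightarrow> M / 1 ^ n) (at_left (1::real))"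
    by (intro tendsto_intros) auto
  moreover have "eventually (\<lambda>r. cmod (Q z) \<le> M / r ^ n) (at_left 1)"
    using eventually_at_left_real[OF z] by eventually_elim (auto intro: le)
  ultimately show ?thesis
    using tendsto_lowerbound by fastforce
qed

section \<open>Power series of functions in \<open>class_A\<close>\<close>

text \<open>The shifted series still converges in the whole disc, so \<open>h\<close> is holomorphic
  at 0 too, with value \<open>a (n + 1)\<close> there.\<close>

lemma class_A_obtain_factor:
  assumes "f \<in> class_A n"
  obtains h where "h holomorphic_on ball 0 1" "\<And>z. cmod z < 1 \<Longrightarrow> f z = z + z ^ (n + 1) * h z"
proof -
  obtain a where a: "\<And>z. z \<in> ball 0 1 \<Longrightarrow> (\<lambda>k. a (n + 1 + k) * z ^ (n + 1 + k)) sums (f z - z)"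
    using assms unfolding class_A_def by blast
  define h where "h z = (if z = 0 then a (n + 1) else (f z - z) / z ^ (n + 1))" for z
  have "(\<lambda>k. a (n + 1 + k) * (z - 0) ^ k) sums h z" if "z \<in> ball 0 1" for z
  proof (cases "z = 0")
    case True
    then show ?thesis
      using powser_sums_zero[of "\<lambda>k. a (n + 1 + k)"] by (simp add: h_def)
  next
    case False
    then show ?thesis
      using sums_divide[OF a[of z], of "z ^ (n + 1)"] that by (simp add: h_def power_add)
  qed
  then have "h holomorphic_on ball 0 1"
    by (rule power_series_holomorphic)
  moreover have "f z = z + z ^ (n + 1) * h z" if "cmod z < 1" for z
  proof (cases "z = 0")
    case True
    then show ?thesis
      using sums_unique2[OF a[of 0], of 0] by simp
  qed (simp add: h_def)
  ultimately show ?thesis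
    using that by blast
qed

lemma class_A_mono:
  assumes "f \<in> class_A n" "m \<le> n"
  shows "f \<in> class_A m"
proof -
  obtain a where a: "\<And>z. z \<in> ball 0 1 \<Longrightarrow> (\<lambda>k. a (n + 1 + k) * z ^ (n + 1 + k)) sums (f z - z)"
    using assms(1) unfolding class_A_def by blast
  define b where "b j = (if j < n + 1 then 0 else a j)" for j
  have "(\<lambda>k. b (m + 1 + k) * z ^ (m + 1 + k)) sums (f z - z)" if "z \<in> ball 0 1" for z
  proof -
    have "(\<lambda>k. b (m + 1 + (k + (n - m))) * z ^ (m + 1 + (k + (n - m)))) sums (f z - z)"
    proof -
      have "m + 1 + (k + (n - m)) = n + 1 + k" for k
        using assms(2) by simp
      then show ?thesis
        using a[OF that] by (simp only:) (simp add: b_def)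
    qed
    then show ?thesis
      by (subst (asm) sums_zero_iff_shift) (auto simp: b_def)
  qed
  then show ?thesis
    using assms(1) unfolding class_A_def by blast
qed

section \<open>The smallest positive root of \<open>phi\<close>\<close>

text \<open>A \<open>LEAST\<close> over the reals is informative only if a minimum is attained. The
  zeros in \<open>{0..b}\<close> form a compact set, nonempty by the intermediate value theorem, and
  \<open>p 0 < 0\<close> keeps them off 0.\<close>

lemma smallest_positive_root:
  fixes p :: "real \<Rightarrow> real"
  assumes cont: "\<And>x. isCont p x" and "p 0 < 0" and "0 < b" "0 \<le> p b"
  shows "0 < smallest_positive_root p" "smallest_positive_root p \<le> b"
    "p (smallest_positive_root p) = 0"
proof -
  let ?Z = "{r \<in> {0..b}. p r = 0}"
  have contp: "continuous_on S p" for S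
    using cont by (simp add: continuous_at_imp_continuous_on)
  have "\<exists>r\<ge>0. r \<le> b \<and> p r = 0"
    using IVT'[of p 0 0 b] assms contp by auto
  then have "?Z \<noteq> {}"
    by auto
  moreover have "compact ?Z"
  proof -
    have "closed ?Z"
      by (intro continuous_closed_preimage_constant contp) auto
    moreover have "bounded ?Z"
      by (rule bounded_subset[of "{0..b}"]) auto
    ultimately show ?thesis
      by (simp add: compact_eq_bounded_closed)
  qed
  ultimately obtain s where s: "s \<in> ?Z" "\<And>r. r \<in> ?Z \<Longrightarrow> s \<le> r"
    using compact_attains_inf[of ?Z] by blast
  have "s \<noteq> 0"
    using s(1) \<open>p 0 < 0\<close> by auto
  with s have "smallest_positive_root p = s"
    unfolding smallest_positive_root_def
    by (intro Least_equality) (auto, metis linorder_le_cases order_trans less_imp_le)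
  with s(1) \<open>s \<noteq> 0\<close> show "0 < smallest_positive_root p" "smallest_positive_root p \<le> b"
    "p (smallest_positive_root p) = 0"
    by auto
qed

text \<open>The substitution exposes the factor \<open>1 - (n + 1) * e\<close>, which will bound
  \<open>cmod (f' z)\<close> from below, while \<open>e\<close> will bound \<open>cmod (h z)\<close>
  from above.\<close>

lemma phi_scaled:
  "phi n \<alpha> lam (real n * (real n + 1 - \<alpha>) * e) = (real n * (real n + 1 - \<alpha>))\<^sup>2 *
     ((1 - \<alpha>) * real n * e * (1 - (real n + 1) * e) + \<alpha> * real n * (real n + 1) * e * (1 + e)
       - lam * (1 - (real n + 1) * e)\<^sup>2)"
  by (simp add: phi_def algebra_simps power2_eq_square)

text \<open>A nonnegative value of \<open>phi\<close> at a point with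
  \<open>(n + 1) * e0 < 1\<close> forces the least root below that point. The resulting
  \<open>(n + 1) * e < 1\<close> later keeps \<open>f'\<close> away from 0.\<close>

lemma smallest_positive_root_phi:
  assumes n: "1 \<le> n" and \<alpha>: "0 \<le> \<alpha>" "\<alpha> < 1" and lam: "0 < lam"
  obtains e where "0 < e" "(real n + 1) * e < 1"
    "smallest_positive_root (phi n \<alpha> lam) = real n * (real n + 1 - \<alpha>) * e"
    "(1 - \<alpha>) * real n * e * (1 - (real n + 1) * e) + \<alpha> * real n * (real n + 1) * e * (1 + e)
       = lam * (1 - (real n + 1) * e)\<^sup>2"
proof -
  define A where "A = real n * (real n + 1 - \<alpha>)"
  define s where "s = smallest_positive_root (phi n \<alpha> lam)"
  have A: "0 < A"
    using n \<alpha> by (simp add: A_def)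
  \<comment> \<open>At this point all terms of the scaled polynomial cancel except the one with factor \<open>\<alpha>\<close>.\<close>
  define e0 where "e0 = lam / ((1 - \<alpha>) * real n + lam * (real n + 1))"
  have k: "0 < (1 - \<alpha>) * real n"
    using n \<alpha> by simp
  have den: "0 < (1 - \<alpha>) * real n + lam * (real n + 1)"
    using k lam by (intro add_pos_nonneg) auto
  have e0: "0 < e0"
    using lam den by (simp add: e0_def)
  have lt: "(real n + 1) * e0 < 1"
    using k den by (simp add: e0_def field_simps)
  have "e0 * ((1 - \<alpha>) * real n + lam * (real n + 1)) = lam"
    using den by (simp add: e0_def)
  then have eq: "(1 - \<alpha>) * real n * e0 = lam * (1 - (real n + 1) * e0)"
    by (simp add: algebra_simps)
  have "phi n \<alpha> lam (A * e0) = A\<^sup>2 * (\<alpha> * real n * (real n + 1) * e0 * (1 + e0))"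
    unfolding A_def phi_scaled eq by (simp add: power2_eq_square)
  then have ge: "0 \<le> phi n \<alpha> lam (A * e0)"
    using \<alpha> e0 by simp
  have neg: "phi n \<alpha> lam 0 < 0"
    using n \<alpha> lam by (simp add: phi_def)
  have cont: "isCont (phi n \<alpha> lam) x" for x
    unfolding phi_def by (intro continuous_intros)
  note s = smallest_positive_root[OF cont neg _ ge, folded s_def]
  have pos: "0 < A * e0"
    using A e0 by simp
  define e where "e = s / A"
  have sA: "s = A * e"
    using A by (simp add: e_def)
  show ?thesis
  proof (rule that[of e])
    show "0 < e"
      using s(1)[OF pos] A by (simp add: e_def)
    have "e \<le> e0"
      using s(2)[OF pos] A by (simp add: sA)
    then have "(real n + 1) * e \<le> (real n + 1) * e0"
      by (intro mult_left_mono) auto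
    with lt show "(real n + 1) * e < 1"
      by linarith
    show "smallest_positive_root (phi n \<alpha> lam) = real n * (real n + 1 - \<alpha>) * e"
      using sA by (simp add: s_def A_def)
    have "phi n \<alpha> lam (A * e) = 0"
      using s(3)[OF pos] sA by simp
    moreover have "A\<^sup>2 \<noteq> 0"
      using A by simp
    ultimately show "(1 - \<alpha>) * real n * e * (1 - (real n + 1) * e)
        + \<alpha> * real n * (real n + 1) * e * (1 + e) = lam * (1 - (real n + 1) * e)\<^sup>2"
      unfolding A_def phi_scaled mult_eq_0_iff by simp
  qed
qed

section \<open>Estimate of the quotient and its limiting values at 0\<close>

text \<open>
  Here \<open>p\<close>, \<open>g\<close>, \<open>S\<close> stand for \<open>f' z\<close>, \<open>f z / z\<close>, \<open>z * f'' z\<close>, and \<open>x\<close> for \<open>cmod z ^ n\<close>. The first term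
  of the split is divided by \<open>p\<close> only once, which is what produces the coefficients of \<open>phi\<close>.
\<close>
lemma quotient_estimate:
  fixes p g S :: complex and \<alpha> lam e m x :: real
  assumes \<alpha>: "0 \<le> \<alpha>" "\<alpha> < 1" and m: "0 \<le> m" and e: "0 < e" "(m + 1) * e < 1"
    and eq: "(1 - \<alpha>) * m * e * (1 - (m + 1) * e) + \<alpha> * m * (m + 1) * e * (1 + e)
       = lam * (1 - (m + 1) * e)\<^sup>2"
    and x: "0 \<le> x" and p: "cmod (p - 1) \<le> (m + 1) * e" and g: "cmod (g - 1) \<le> e"
    and pg: "cmod (p - g) \<le> x * (m * e)" and S: "cmod S \<le> x * (m * (m + 1) * e)"
  shows "cmod ((1 - of_real \<alpha> + of_real \<alpha> * (S / p)) / (p / g) - (1 - of_real \<alpha>)) \<le> x * lam"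
proof -
  define d where "d = 1 - (m + 1) * e"
  have d: "0 < d"
    using e by (simp add: d_def)
  have dp: "d \<le> cmod p"
    using p norm_triangle_ineq2[of 1 "1 - p"] by (simp add: d_def norm_minus_commute)
  have p0: "p \<noteq> 0"
    using d dp by auto
  have g1: "cmod g \<le> 1 + e"
    using g norm_triangle_ineq[of 1 "g - 1"] by simp
  \<comment> \<open>This also covers \<open>g = 0\<close>: division by 0 gives 0, and both sides
    become \<open>-(1 - \<alpha>)\<close>.\<close>
  have "(1 - of_real \<alpha> + of_real \<alpha> * (S / p)) / (p / g) - (1 - of_real \<alpha>)
      = of_real (1 - \<alpha>) * (g - p) / p + of_real \<alpha> * S * g / p\<^sup>2"
    using p0 by (simp add: field_simps power2_eq_square)
  also have "cmod \<dots> \<le> (1 - \<alpha>) * cmod (p - g) / cmod p + \<alpha> * cmod S * cmod g / (cmod p)\<^sup>2"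
    using \<alpha> norm_triangle_ineq
    by (metis (no_types, lifting) abs_of_nonneg diff_ge_0_iff_ge less_imp_le norm_divide norm_minus_commute
        norm_mult norm_of_real norm_power)
  also have "\<dots> \<le> (1 - \<alpha>) * (x * (m * e)) / d + \<alpha> * (x * (m * (m + 1) * e)) * (1 + e) / d\<^sup>2"
    using \<alpha> m e x d dp g1 pg S
    by (intro add_mono frac_le mult_mono mult_left_mono power_mono mult_nonneg_nonneg) auto
  also have "\<dots> = x * ((1 - \<alpha>) * m * e * d + \<alpha> * m * (m + 1) * e * (1 + e)) / d\<^sup>2"
    using d by (simp add: field_simps power2_eq_square)
  also have "\<dots> = x * lam"
    using d eq by (simp add: d_def)
  finally show ?thesis .
qed

text \<open>The limit ignores \<open>h 0\<close>, so a default such as \<open>0 / 0\<close> there is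
  harmless; the continuous \<open>k\<close> supplies the value.\<close>

lemma at0_limit_eq:
  assumes "isCont k 0" "\<And>w. w \<noteq> 0 \<Longrightarrow> cmod w < 1 \<Longrightarrow> h w = k w" "cmod z < 1"
  shows "at0_limit h z = k z"
proof (cases "z = 0")
  case True
  have "eventually (\<lambda>w. h w = k w) (at 0)"
    unfolding eventually_at using assms(2) by (intro exI[of _ 1]) auto
  then have "(h \<longlongrightarrow> k 0) (at 0)"
    using assms(1) by (subst tendsto_cong) (auto simp: isCont_def)
  then show ?thesis
    using True by (simp add: at0_limit_def tendsto_Lim)
qed (use assms in \<open>simp add: at0_limit_def\<close>)

theorem theorem2p4:
  fixes n :: nat and f :: "complex \<Rightarrow> complex" and \<alpha> lam \<delta> :: real
  assumes "1 \<le> n"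
    and "f \<in> class_A n"
    and "0 \<le> \<alpha>" and "\<alpha> < 1"
    and "0 < lam"
    and "\<delta> = smallest_positive_root (phi n \<alpha> lam)"
    and "\<forall>z\<in>ball 0 1. cmod (z * deriv (deriv f) z - of_real \<alpha> * (deriv f z - 1))
           < \<delta> * (real n + 1) * (real n - \<alpha>) / (\<alpha> + (real n + 1) * (real n - \<alpha>))"
  shows "f \<in> class_G lam \<alpha>"
proof -
  let ?N = "real n"
  obtain e where e: "0 < e" "(?N + 1) * e < 1" and \<delta>: "\<delta> = ?N * (?N + 1 - \<alpha>) * e"
    and eq: "(1 - \<alpha>) * ?N * e * (1 - (?N + 1) * e) + \<alpha> * ?N * (?N + 1) * e * (1 + e)
       = lam * (1 - (?N + 1) * e)\<^sup>2"
    using smallest_positive_root_phi[of n \<alpha> lam] assms(1,3-6) by metis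
  have n\<alpha>: "0 < ?N - \<alpha>"
    using assms(1,4) by simp
  \<comment> \<open>The denominator in the hypothesis equals \<open>n * (n + 1 - \<alpha>)\<close>
    and cancels against \<open>\<delta>\<close>. What remains is \<open>e\<close> times the two
    constants that will be divided out in passing to \<open>q\<close> and then to
    \<open>h\<close>.\<close>
  define M where "M = (?N + 1) * (?N - \<alpha>) * e"
  have "\<alpha> + (?N + 1) * (?N - \<alpha>) = ?N * (?N + 1 - \<alpha>)"
    by algebra
  moreover have "?N * (?N + 1 - \<alpha>) \<noteq> 0"
    using assms(1) n\<alpha> by simp
  ultimately have M: "\<delta> * (?N + 1) * (?N - \<alpha>) / (\<alpha> + (?N + 1) * (?N - \<alpha>)) = M"
    by (simp add: \<delta> M_def)

  obtain h where h: "h holomorphic_on ball 0 1"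
    and fh: "\<And>z. cmod z < 1 \<Longrightarrow> f z = z + z ^ (n + 1) * h z"
    using class_A_obtain_factor[OF assms(2)] by blast
  define q where "q = euler_op (of_real (?N + 1)) h"
  define g where "g z = 1 + z ^ n * h z" for z
  have q: "q holomorphic_on ball 0 1"
    using h unfolding q_def by (intro holomorphic_intros) auto
  have f_eq: "f z = z * g z" if "cmod z < 1" for z
    using fh[OF that] by (simp add: g_def algebra_simps)
  have f': "deriv f z = 1 + z ^ n * q z" if "cmod z < 1" for z
  proof (rule DERIV_imp_deriv)
    have "((\<lambda>z. z + z ^ Suc n * h z) has_field_derivative 1 + z ^ n * q z) (at z)"
      using DERIV_add[OF DERIV_ident has_field_derivative_power_mult[OF h, of z n]] that
      by (simp add: q_def add.commute)
    then show "(f has_field_derivative 1 + z ^ n * q z) (at z)"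
      using that fh by (elim has_field_derivative_transform_within_open[of _ _ _ "ball 0 1"]) auto
  qed
  have f'': "z * deriv (deriv f) z = z ^ n * euler_op (of_real ?N) q z" if "cmod z < 1" for z
  proof -
    \<comment> \<open>Differentiating leaves \<open>z ^ m\<close>; the extra factor \<open>z\<close>
      restores \<open>z ^ n\<close>.\<close>
    obtain m where m: "n = Suc m"
      using assms(1) by (cases n) auto
    have "((\<lambda>z. 1 + z ^ Suc m * q z) has_field_derivative z ^ m * euler_op (of_real ?N) q z) (at z)"
      using DERIV_add[OF DERIV_const has_field_derivative_power_mult[OF q, of z m]] that
      by (simp add: m)
    then have "(deriv f has_field_derivative z ^ m * euler_op (of_real ?N) q z) (at z)"
      using that f' by (elim has_field_derivative_transform_within_open[of _ _ _ "ball 0 1"]) (auto simp: m)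
    then show ?thesis
      by (simp add: DERIV_imp_deriv m)
  qed

  have Qb: "cmod (euler_op (of_real (?N - \<alpha>)) q z) \<le> M" if "cmod z < 1" for z
  proof (rule norm_le_of_power_mult_bound[OF _ _ that])
    show "euler_op (of_real (?N - \<alpha>)) q holomorphic_on ball 0 1"
      using q by (intro holomorphic_intros) auto
    fix w :: complex assume w: "cmod w < 1"
    have "w ^ n * euler_op (of_real (?N - \<alpha>)) q w
        = w * deriv (deriv f) w - of_real \<alpha> * (deriv f w - 1)"
      by (simp add: f''[OF w] f'[OF w] euler_op_def algebra_simps)
    then show "cmod (w ^ n * euler_op (of_real (?N - \<alpha>)) q w) \<le> M"
      using assms(7) w unfolding M by (simp add: less_imp_le)
  qed
  have qb: "cmod (q z) \<le> (?N + 1) * e" if "cmod z < 1" for z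
    using norm_le_of_euler_op_bound[OF q n\<alpha> Qb that] n\<alpha> by (simp add: M_def)
  have hb: "cmod (h z) \<le> e" if "cmod z < 1" for z
    using norm_le_of_euler_op_bound[OF h _ _ that, of "?N + 1" "(?N + 1) * e"] qb
    by (simp add: q_def)
  have Sb: "cmod (euler_op (of_real ?N) q z) \<le> ?N * (?N + 1) * e" if "cmod z < 1" for z
  proof -
    \<comment> \<open>Shifting the constant from \<open>n - \<alpha>\<close> to \<open>n\<close>
      costs \<open>\<alpha> * q\<close>, and the two bounds add up without any remaining
      \<open>\<alpha>\<close>.\<close>
    have "euler_op (of_real ?N) q z = euler_op (of_real (?N - \<alpha>)) q z + of_real \<alpha> * q z"
      by (simp add: euler_op_def algebra_simps)
    also have "cmod \<dots> \<le> M + \<alpha> * ((?N + 1) * e)"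
      using Qb[OF that] qb[OF that] assms(3)
      by (intro norm_triangle_le add_mono) (auto simp: norm_mult intro!: mult_left_mono)
    also have "\<dots> = ?N * (?N + 1) * e"
      by (simp add: M_def algebra_simps)
    finally show ?thesis .
  qed
  have ub: "cmod (euler_op (of_real ?N) h z) \<le> ?N * e" if "cmod z < 1" for z
  proof -
    \<comment> \<open>After commuting, the operator with constant \<open>n + 1\<close> is outermost,
      so \<open>Sb\<close> may be divided by \<open>n + 1\<close>.\<close>
    have "cmod (euler_op (of_real ?N) h z) \<le> ?N * (?N + 1) * e / (?N + 1)"
    proof (rule norm_le_of_euler_op_bound[OF _ _ _ that])
      show "euler_op (of_real ?N) h holomorphic_on ball 0 1"
        using h by (intro holomorphic_intros) auto
      show "cmod (euler_op (of_real (?N + 1)) (euler_op (of_real ?N) h) w) \<le> ?N * (?N + 1) * e"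
        if "cmod w < 1" for w
        using Sb[OF that] euler_op_commute[OF h, of w] that unfolding q_def by simp
    qed simp
    then show ?thesis
      by simp
  qed

  have p1: "cmod (deriv f z - 1) \<le> (?N + 1) * e" if "cmod z < 1" for z
    using f'[OF that] mult_mono[OF power_le_one[of "cmod z" n] qb[OF that]] that
    by (simp add: norm_mult norm_power)
  have g1: "cmod (g z - 1) \<le> e" if "cmod z < 1" for z
    using mult_mono[OF power_le_one[of "cmod z" n] hb[OF that]] that
    by (simp add: g_def norm_mult norm_power)
  have f'_nz: "deriv f z \<noteq> 0" if "cmod z < 1" for z
    using p1[OF that] e by auto
  have g_nz: "g z \<noteq> 0" if "cmod z < 1" for z
  proof -
    have "e \<le> (?N + 1) * e"
      using e(1) by simp
    with e(2) have "e < 1"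
      by linarith
    then show ?thesis
      using g1[OF that] by auto
  qed
  have hol_f': "deriv f holomorphic_on ball 0 1"
  proof -
    have "(\<lambda>z. 1 + z ^ n * q z) holomorphic_on ball 0 1"
      using q by (intro holomorphic_intros)
    then show ?thesis
      by (rule holomorphic_transform) (simp add: f')
  qed
  have cont: "isCont (deriv f) 0" "isCont (deriv (deriv f)) 0" "isCont g 0"
  proof -
    have "g holomorphic_on ball 0 1"
      using h unfolding g_def by (intro holomorphic_intros)
    moreover have "deriv (deriv f) holomorphic_on ball 0 1"
      using hol_f' by (rule holomorphic_deriv) auto
    ultimately show "isCont (deriv f) 0" "isCont (deriv (deriv f)) 0" "isCont g 0"
      using hol_f' by (auto simp: continuous_on_eq_continuous_at dest!: holomorphic_on_imp_continuous_on)
  qed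
  have lim1: "at0_limit (\<lambda>w. w * deriv (deriv f) w / deriv f w) z = z * deriv (deriv f) z / deriv f z"
    if "cmod z < 1" for z
    using that f'_nz by (intro at0_limit_eq continuous_intros cont) auto
  \<comment> \<open>Cancelling \<open>w\<close> in \<open>w * f' / f\<close> leaves
    \<open>f' / g\<close>, which is continuous at 0.\<close>
  have lim2: "at0_limit (\<lambda>w. w * deriv f w / f w) z = deriv f z / g z" if "cmod z < 1" for z
    using that g_nz by (intro at0_limit_eq continuous_intros cont) (auto simp: f_eq)

  have main: "cmod ((1 - of_real \<alpha> + of_real \<alpha> * (z * deriv (deriv f) z / deriv f z))
      / (deriv f z / g z) - (1 - of_real \<alpha>)) < lam" if z: "cmod z < 1" for z
  proof -
    have "deriv f z - g z = z ^ n * euler_op (of_real ?N) h z"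
      by (simp add: f'[OF z] g_def q_def euler_op_def algebra_simps)
    then have "cmod (deriv f z - g z) \<le> cmod z ^ n * (?N * e)"
      using ub[OF z] by (simp add: norm_mult norm_power mult_left_mono)
    moreover have "cmod (z * deriv (deriv f) z) \<le> cmod z ^ n * (?N * (?N + 1) * e)"
      using Sb[OF z] unfolding f''[OF z] norm_mult norm_power by (intro mult_left_mono) auto
    ultimately have "cmod ((1 - of_real \<alpha> + of_real \<alpha> * (z * deriv (deriv f) z / deriv f z))
      / (deriv f z / g z) - (1 - of_real \<alpha>)) \<le> cmod z ^ n * lam"
      using assms(3,4) e eq p1[OF z] g1[OF z] by (intro quotient_estimate) auto
    \<comment> \<open>The preceding estimate is not strict; strictness comes from
      \<open>cmod z ^ n < 1\<close>, where \<open>n\<close> is positive.\<close>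
    also have "\<dots> < 1 * lam"
      using assms(1,5) z by (intro mult_strict_right_mono) (auto simp: power_less_one_iff)
    finally show ?thesis
      by simp
  qed
  show ?thesis
    unfolding class_G_def using class_A_mono[OF assms(2,1)] main f'_nz g_nz f_eq
    by (auto simp: lim1 lim2)
qed

end
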